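(* Let $q(x)=\sum_{i=1}^n 2\alpha_i x_i+\sum_{i=1}^n\beta_i x_i^2$ for some scalars $\alpha_i,\beta_i\in\mathbb{R}$. Then the doubly nonnegative relaxation of the standard quadratic programming problem $$\min\{q(x) : x\in\Delta^n\}$$ is tight, i.e. its optimal value $z_{\mathrm{DNN}}$ equals $\min\{q(x): x\in\Delta^n\}$.
   Context: $\Delta^n=\{x\in\mathbb{R}^n : x\ge 0,\ e^\top x=1\}$ is the standard simplex, where $e$ is the all-ones vector, and $E=ee^\top$. On $\Delta^n$ one has $q(x)=x^\top Q x$, where $Q$ is the real symmetric $n\times n$ matrix $Q=\mathrm{diag}(\beta_1,\dots,\beta_n)+\alpha e^\top+e\alpha^\top$, with $\alpha=(\alpha_1,\dots,\alpha_n)^\top$; so $Q_{ii}=\beta_i+2\alpha_i$ and $Q_{ij}=\alpha_i+\alpha_j$ for $i\neq j$. The doubly nonnegative (DNN) relaxation is $z_{\mathrm{DNN}}=\min\{Q\bullet X : E\bullet X=1,\ X\in\mathcal{DNN}_n\}$, where $A\bullet B=\mathrm{trace}(AB)$ and $\mathcal{DNN}_n$ is the cone of symmetric $n\times n$ matrices that are both positive semidefinite and entrywise nonnegative. *)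

theory Defs
  imports "HOL-Analysis.Analysis"
begin

text \<open>\<open>n = CARD('n) \<ge> 1\<close>, and \<open>1 :: real ^ 'n\<close> is the all-ones vector \<open>e\<close>.\<close>

definition std_simplex :: "(real ^ 'n) set" where
  "std_simplex = {x. (\<forall>i. 0 \<le> x $ i) \<and> 1 \<bullet> x = 1}"

definition sep_quad :: "real ^ 'n \<Rightarrow> real ^ 'n \<Rightarrow> real ^ 'n \<Rightarrow> real" where
  "sep_quad \<alpha> \<beta> x = (\<Sum>i\<in>UNIV. 2 * \<alpha> $ i * x $ i) + (\<Sum>i\<in>UNIV. \<beta> $ i * (x $ i)\<^sup>2)"

definition diag_mat :: "real ^ 'n \<Rightarrow> real ^ 'n ^ 'n" where
  "diag_mat v = (\<chi> i j. if i = j then v $ i else 0)"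

definition outer_prod :: "real ^ 'n \<Rightarrow> real ^ 'n \<Rightarrow> real ^ 'n ^ 'n" where
  "outer_prod u v = (columnvector u :: real ^ 1 ^ 'n) ** (rowvector v :: real ^ 'n ^ 1)"

definition quad_mat :: "real ^ 'n \<Rightarrow> real ^ 'n \<Rightarrow> real ^ 'n ^ 'n" where
  "quad_mat \<alpha> \<beta> = diag_mat \<beta> + outer_prod \<alpha> 1 + outer_prod 1 \<alpha>"

text \<open>The product is named rather than written infix: on matrices, \<open>\<bullet>\<close> is already the
  library's inner product.\<close>

definition trace_prod :: "real ^ 'n ^ 'n \<Rightarrow> real ^ 'n ^ 'n \<Rightarrow> real" where
  "trace_prod A B = trace (A ** B)"

definition dnn_cone :: "(real ^ 'n ^ 'n) set" where
  "dnn_cone = {X. transpose X = X \<and> (\<forall>v. 0 \<le> v \<bullet> (X *v v)) \<and> (\<forall>i j. 0 \<le> X $ i $ j)}"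

definition dnn_feasible :: "(real ^ 'n ^ 'n) set" where
  "dnn_feasible = {X \<in> dnn_cone. trace_prod (outer_prod 1 1) X = 1}"

text \<open>\<open>z = min {f x | x \<in> S}\<close>, including the claim that the minimum is attained; such a \<open>z\<close>
  is unique.\<close>

definition is_min_value :: "('a \<Rightarrow> real) \<Rightarrow> 'a set \<Rightarrow> real \<Rightarrow> bool" where
  "is_min_value f S z \<longleftrightarrow> (\<exists>x. is_arg_min f (\<lambda>x. x \<in> S) x \<and> f x = z)"

lemma outer_prod_nth: "outer_prod u v $ i $ j = u $ i * v $ j"
  by (simp add: outer_prod_def matrix_matrix_mult_def columnvector_def rowvector_def)

lemma quad_mat_nth:
  "quad_mat \<alpha> \<beta> $ i $ j = (if i = j then \<beta> $ i + 2 * \<alpha> $ i else \<alpha> $ i + \<alpha> $ j)"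
  by (simp add: quad_mat_def diag_mat_def outer_prod_nth)

lemma sep_quad_eq_quad_form:
  assumes "x \<in> std_simplex"
  shows "sep_quad \<alpha> \<beta> x = x \<bullet> (quad_mat \<alpha> \<beta> *v x)"
proof -
  have 1: "(\<Sum>i\<in>UNIV. x $ i) = 1"
    using assms by (simp add: std_simplex_def inner_vec_def)
  have "(quad_mat \<alpha> \<beta> *v x) $ i = \<beta> $ i * x $ i + \<alpha> $ i + (\<Sum>j\<in>UNIV. \<alpha> $ j * x $ j)" for i
  proof -
    have "(quad_mat \<alpha> \<beta> *v x) $ i
        = (\<Sum>j\<in>UNIV. (if i = j then \<beta> $ i * x $ j else 0) + \<alpha> $ i * x $ j + \<alpha> $ j * x $ j)"
      unfolding matrix_vector_mult_def by (auto simp: quad_mat_nth algebra_simps intro!: sum.cong)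
    also have "\<dots> = \<beta> $ i * x $ i + \<alpha> $ i * (\<Sum>j\<in>UNIV. x $ j) + (\<Sum>j\<in>UNIV. \<alpha> $ j * x $ j)"
      by (simp add: sum.distrib sum_distrib_left)
    finally show ?thesis using 1 by simp
  qed
  then have "x \<bullet> (quad_mat \<alpha> \<beta> *v x)
      = (\<Sum>i\<in>UNIV. \<beta> $ i * (x $ i)\<^sup>2 + \<alpha> $ i * x $ i + x $ i * (\<Sum>j\<in>UNIV. \<alpha> $ j * x $ j))"
    by (simp add: inner_vec_def algebra_simps power2_eq_square)
  also have "\<dots> = (\<Sum>i\<in>UNIV. \<beta> $ i * (x $ i)\<^sup>2) + 2 * (\<Sum>i\<in>UNIV. \<alpha> $ i * x $ i)"
    using 1 by (simp add: sum.distrib flip: sum_distrib_right)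
  finally show ?thesis
    by (simp add: sep_quad_def sum_distrib_left mult.assoc)
qed

end

theory Submission
  imports Defs
begin

text \<open>Every point \<open>x\<close> of the simplex yields the feasible matrix \<open>x x\<^sup>T\<close> with objective value
  \<open>q(x)\<close>, so everything rests on the lower bound: if \<open>z \<le> q\<close> on the simplex, then
  \<open>z \<le> Q \<bullet> X\<close> for every feasible \<open>X\<close>. Write \<open>x = X e\<close>; then
  \<open>Q \<bullet> X = (\<Sum>i. 2 \<alpha>\<^sub>i x\<^sub>i + \<beta>\<^sub>i X\<^sub>i\<^sub>i)\<close>, and it suffices to find a probability distribution on
  the simplex with mean \<open>x\<close> and second moments \<open>m\<^sub>i\<close> such that \<open>(\<Sum>i. \<beta>\<^sub>i m\<^sub>i) \<le> (\<Sum>i. \<beta>\<^sub>i X\<^sub>i\<^sub>i)\<close>.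

  Let \<open>N\<close> be the set of indices with \<open>\<beta>\<^sub>i \<le> 0\<close>. Moving each entry \<open>X\<^sub>i\<^sub>k\<close> with distinct
  \<open>i, k \<in> N\<close> onto the diagonal adds the positive semidefinite Laplacian of these entries, keeps
  all row sums, and does not increase the objective
  (\<open>diagonalize_block_dnn_feasible\<close>, \<open>trace_prod_diagonalize_block_le\<close>). Hence the block of \<open>X\<close>
  on \<open>N\<close> may be assumed diagonal, and its Schur complement (\<open>psd_schur_complement\<close>) suggests the
  distribution: the points \<open>y\<^sup>i = X\<^sub>i / x\<^sub>i\<close>, made from the nonzero rows \<open>i \<in> N\<close>, with weights
  \<open>x\<^sub>i\<^sup>2 / X\<^sub>i\<^sub>i\<close>, and one further point \<open>b\<close>, vanishing on \<open>N\<close>, that carries the remaining weight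
  \<open>w\<^sub>0\<close> and restores the mean. Semidefiniteness of the Schur complement bounds the second
  moments, so the average of \<open>q\<close> is at most \<open>Q \<bullet> X\<close> (\<open>trace_prod_ge_of_diagonal_block\<close>).

  The point \<open>b\<close> may have negative entries. This is repaired in \<open>average_ge_simplex_min\<close>:
  minimise the average of \<open>q\<close> over all ways to move the \<open>y\<^sup>i\<close> within the simplex with their
  coordinates in \<open>N\<close> fixed, \<open>b\<close> being determined by the mean. If \<open>b\<^sub>j < 0\<close> at the minimum, some
  \<open>y\<^sup>i\<close> exceeds \<open>b\<close> at \<open>j\<close>, and then falls below \<open>b\<close> at some \<open>k\<close>; shifting mass from \<open>j\<close> to
  \<open>k\<close> in \<open>y\<^sup>i\<close>, and back in \<open>b\<close>, brings the two points closer together in coordinates where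
  \<open>q\<close> is strictly convex, and lowers the average (\<open>sep_quad_exchange\<close>). So at the minimum all
  points lie in the simplex, and the average is at least \<open>z\<close>.\<close>

section \<open>Quadratic forms and separable functions\<close>

lemma inner_matrix_vector_eq_sum:
  fixes X :: "real ^ 'n ^ 'n"
  shows "v \<bullet> (X *v v) = (\<Sum>i\<in>UNIV. \<Sum>j\<in>UNIV. X $ i $ j * v $ i * v $ j)"
  by (simp add: inner_vec_def matrix_vector_mult_def sum_distrib_left mult_ac)

lemma inner_matrix_vector_commute:
  fixes X :: "real ^ 'n ^ 'n"
  assumes "transpose X = X"
  shows "u \<bullet> (X *v v) = v \<bullet> (X *v u)"
  by (metis assms dot_lmul_matrix inner_commute transpose_matrix_vector)

lemma symmetric_nth:
  assumes "transpose X = X"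
  shows "X $ i $ j = X $ j $ i"
  by (metis assms transpose_def vec_lambda_beta)

lemma sum_eq_one_simplex: "x \<in> std_simplex \<Longrightarrow> (\<Sum>i\<in>UNIV. x $ i) = 1"
  by (simp add: std_simplex_def inner_vec_def)

lemma std_simplexI:
  assumes "\<And>i. 0 \<le> x $ i" "(\<Sum>i\<in>UNIV. x $ i) = 1"
  shows "x \<in> std_simplex"
  using assms by (simp add: std_simplex_def inner_vec_def)

lemma simplex_norm_le_one:
  assumes "x \<in> std_simplex"
  shows "norm x \<le> 1"
proof -
  have "norm x \<le> (\<Sum>i\<in>UNIV. \<bar>x $ i\<bar>)"
    by (rule norm_le_l1_cart)
  also have "\<dots> = (\<Sum>i\<in>UNIV. x $ i)"
    using assms by (intro sum.cong) (auto simp: std_simplex_def)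
  finally show ?thesis using sum_eq_one_simplex[OF assms] by simp
qed

lemma closed_std_simplex: "closed (std_simplex :: (real ^ 'n) set)"
  unfolding std_simplex_def
  by (intro closed_Collect_conj closed_Collect_all closed_Collect_le closed_Collect_eq
      continuous_intros)

lemma compact_std_simplex: "compact (std_simplex :: (real ^ 'n) set)"
  using closed_std_simplex simplex_norm_le_one
  by (auto simp: compact_eq_bounded_closed bounded_iff)

lemma continuous_on_sep_quad [continuous_intros]:
  assumes "continuous_on S f"
  shows "continuous_on S (\<lambda>x. sep_quad \<alpha> \<beta> (f x))"
  unfolding sep_quad_def by (intro continuous_intros assms)

lemma sep_quad_attains_min:
  fixes \<alpha> \<beta> :: "real ^ 'n"
  obtains x where "x \<in> std_simplex" "\<And>y. y \<in> std_simplex \<Longrightarrow> sep_quad \<alpha> \<beta> x \<le> sep_quad \<alpha> \<beta> y"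
proof -
  have "axis undefined 1 \<in> (std_simplex :: (real ^ 'n) set)"
    by (rule std_simplexI) (auto simp: axis_def)
  then have "(std_simplex :: (real ^ 'n) set) \<noteq> {}" by blast
  from continuous_attains_inf[OF compact_std_simplex this, of "sep_quad \<alpha> \<beta>"]
  show ?thesis using that continuous_on_sep_quad[of _ "\<lambda>x. x"] continuous_on_id by blast
qed

text \<open>With \<open>x / 0 = 0\<close>, the third conclusion also holds, and is used, for \<open>a = 0\<close>.\<close>

lemma psd_binary_form:
  fixes a b c :: real
  assumes "\<And>s t. 0 \<le> a * s\<^sup>2 + 2 * b * (s * t) + c * t\<^sup>2"
  shows "0 \<le> a" "a = 0 \<Longrightarrow> b = 0" "b\<^sup>2 / a \<le> c"
proof -
  show a: "0 \<le> a" using assms[of 1 0] by simp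
  show b: "b = 0" if "a = 0"
  proof -
    have "a * (- (c + 1) / 2)\<^sup>2 + 2 * b * (- (c + 1) / 2 * b) + c * b\<^sup>2 = - b\<^sup>2"
      using that by (simp add: field_simps power2_eq_square)
    then have "b\<^sup>2 \<le> 0" using assms[of "- (c + 1) / 2" b] by linarith
    then show ?thesis by simp
  qed
  show "b\<^sup>2 / a \<le> c"
  proof (cases "a = 0")
    case True
    then show ?thesis using assms[of 0 1] by simp
  next
    case False
    then have "0 < a" using a by simp
    have "0 \<le> a * (a * c - b\<^sup>2)"
      using assms[of "- b" a] by (simp add: algebra_simps power2_eq_square)
    then have "b\<^sup>2 \<le> a * c" using \<open>0 < a\<close> by (simp add: zero_le_mult_iff)
    then show ?thesis using \<open>0 < a\<close> by (simp add: field_simps)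
  qed
qed

lemma trace_prod_quad_mat:
  assumes "transpose X = X"
  shows "trace_prod (quad_mat \<alpha> \<beta>) X
    = (\<Sum>i\<in>UNIV. \<beta> $ i * X $ i $ i) + 2 * (\<Sum>i\<in>UNIV. \<alpha> $ i * (\<Sum>j\<in>UNIV. X $ i $ j))"
proof -
  have "trace_prod (quad_mat \<alpha> \<beta>) X
      = (\<Sum>i\<in>UNIV. \<Sum>j\<in>UNIV. (if i = j then \<beta> $ i * X $ j $ i else 0)
          + \<alpha> $ i * X $ j $ i + \<alpha> $ j * X $ j $ i)"
    unfolding trace_prod_def trace_def matrix_matrix_mult_def
    by (auto simp: quad_mat_nth algebra_simps intro!: sum.cong)
  also have "\<dots> = (\<Sum>i\<in>UNIV. \<beta> $ i * X $ i $ i) + (\<Sum>i\<in>UNIV. \<Sum>j\<in>UNIV. \<alpha> $ i * X $ j $ i)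
      + (\<Sum>i\<in>UNIV. \<Sum>j\<in>UNIV. \<alpha> $ j * X $ j $ i)"
    by (simp add: sum.distrib)
  also have "(\<Sum>i\<in>UNIV. \<Sum>j\<in>UNIV. \<alpha> $ j * X $ j $ i) = (\<Sum>i\<in>UNIV. \<Sum>j\<in>UNIV. \<alpha> $ i * X $ i $ j)"
    by (rule sum.swap)
  also have "(\<Sum>i\<in>UNIV. \<Sum>j\<in>UNIV. \<alpha> $ i * X $ j $ i) = (\<Sum>i\<in>UNIV. \<Sum>j\<in>UNIV. \<alpha> $ i * X $ i $ j)"
    by (simp add: symmetric_nth[OF assms])
  finally show ?thesis by (simp add: sum_distrib_left)
qed

lemma trace_prod_ones:
  "trace_prod (outer_prod 1 1) X = (\<Sum>i\<in>UNIV. \<Sum>j\<in>UNIV. X $ i $ j)"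
  unfolding trace_prod_def trace_def matrix_matrix_mult_def
  by (simp add: outer_prod_nth) (rule sum.swap)

lemma outer_prod_dnn_feasible:
  assumes "x \<in> std_simplex"
  shows "outer_prod x x \<in> dnn_feasible"
    and "trace_prod (quad_mat \<alpha> \<beta>) (outer_prod x x) = sep_quad \<alpha> \<beta> x"
proof -
  have s: "(\<Sum>i\<in>UNIV. x $ i) = 1" by (rule sum_eq_one_simplex[OF assms])
  have t: "transpose (outer_prod x x) = outer_prod x x"
    by (simp add: vec_eq_iff transpose_def outer_prod_nth)
  have "v \<bullet> (outer_prod x x *v v) = (\<Sum>i\<in>UNIV. x $ i * v $ i)\<^sup>2" for v
    by (simp add: inner_matrix_vector_eq_sum outer_prod_nth power2_eq_square sum_product mult_ac)
  moreover have "(\<Sum>i\<in>UNIV. \<Sum>j\<in>UNIV. x $ i * x $ j) = 1"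
    using s by (simp flip: sum_product)
  ultimately show "outer_prod x x \<in> dnn_feasible"
    using assms t
    by (simp add: dnn_feasible_def dnn_cone_def trace_prod_ones outer_prod_nth std_simplex_def)
  show "trace_prod (quad_mat \<alpha> \<beta>) (outer_prod x x) = sep_quad \<alpha> \<beta> x"
    using s by (simp add: trace_prod_quad_mat[OF t] outer_prod_nth sep_quad_def power2_eq_square
        sum_distrib_left[symmetric] mult.assoc)
qed


section \<open>Removing negative coordinates by exchange\<close>

text \<open>Two points of weights \<open>w\<close> and \<open>w0\<close> that differ in opposite directions at \<open>j\<close> and at \<open>k\<close>
  are moved towards each other along \<open>e\<^sub>k - e\<^sub>j\<close> with their weighted mean fixed. The linear
  part of the separable function is unaffected, and the first-order change of the convex part
  is negative. The bound \<open>M\<close> serves to keep the moved point nonnegative.\<close>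

lemma sep_quad_exchange:
  fixes y b :: "real ^ 'n"
  assumes "0 < w" "0 < w0" "j \<noteq> k" "0 < \<beta> $ j" "0 < \<beta> $ k" "0 < M"
    and "b $ j < y $ j" "y $ k < b $ k"
  obtains \<epsilon> where "0 < \<epsilon>" "\<epsilon> \<le> M"
    "w * sep_quad \<alpha> \<beta> (y + \<epsilon> *\<^sub>R (axis k 1 - axis j 1))
       + w0 * sep_quad \<alpha> \<beta> (b - (w * \<epsilon> / w0) *\<^sub>R (axis k 1 - axis j 1))
     < w * sep_quad \<alpha> \<beta> y + w0 * sep_quad \<alpha> \<beta> b"
proof -
  define d :: "real ^ 'n" where "d = axis k 1 - axis j 1"
  define L where "L = (\<Sum>i\<in>UNIV. 2 * \<alpha> $ i * d $ i)"
  have expand: "sep_quad \<alpha> \<beta> (u + t *\<^sub>R d)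
      = sep_quad \<alpha> \<beta> u + t * L + 2 * t * (\<beta> $ k * u $ k - \<beta> $ j * u $ j) + t\<^sup>2 * (\<beta> $ k + \<beta> $ j)"
    for u t
  proof -
    have "sep_quad \<alpha> \<beta> (u + t *\<^sub>R d) = sep_quad \<alpha> \<beta> u + t * L
        + 2 * t * (\<Sum>i\<in>UNIV. \<beta> $ i * u $ i * d $ i) + t\<^sup>2 * (\<Sum>i\<in>UNIV. \<beta> $ i * (d $ i)\<^sup>2)"
      by (simp add: sep_quad_def L_def sum_distrib_left power2_eq_square algebra_simps
          flip: sum.distrib)
    moreover have "(\<Sum>i\<in>UNIV. \<beta> $ i * u $ i * d $ i) = \<beta> $ k * u $ k - \<beta> $ j * u $ j"
    proof -
      have "(\<Sum>i\<in>UNIV. \<beta> $ i * u $ i * d $ i)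
        = (\<Sum>i\<in>UNIV. (if i = k then \<beta> $ i * u $ i else 0) - (if i = j then \<beta> $ i * u $ i else 0))"
        by (intro sum.cong) (auto simp: d_def axis_def)
      then show ?thesis by (simp add: sum_subtractf)
    qed
    moreover have "(\<Sum>i\<in>UNIV. \<beta> $ i * (d $ i)\<^sup>2) = \<beta> $ k + \<beta> $ j"
    proof -
      have "(\<Sum>i\<in>UNIV. \<beta> $ i * (d $ i)\<^sup>2)
        = (\<Sum>i\<in>UNIV. (if i = k then \<beta> $ i else 0) + (if i = j then \<beta> $ i else 0))"
        using \<open>j \<noteq> k\<close> by (intro sum.cong) (auto simp: d_def axis_def)
      then show ?thesis by (simp add: sum.distrib)
    qed
    ultimately show ?thesis by simp
  qed
  define G where "G = \<beta> $ k * (b $ k - y $ k) + \<beta> $ j * (y $ j - b $ j)"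
  define H where "H = (\<beta> $ k + \<beta> $ j) * (1 + w / w0)"
  have "0 < G" unfolding G_def using assms by (intro add_pos_pos mult_pos_pos) auto
  have "0 < H" unfolding H_def using assms by (intro mult_pos_pos add_pos_pos) auto
  define \<epsilon> where "\<epsilon> = min M (G / H)"
  have e: "0 < \<epsilon>" "\<epsilon> \<le> M" "\<epsilon> * H \<le> G"
    using \<open>0 < G\<close> \<open>0 < H\<close> \<open>0 < M\<close> by (auto simp: \<epsilon>_def min_def field_simps)
  have "w * sep_quad \<alpha> \<beta> (y + \<epsilon> *\<^sub>R d) + w0 * sep_quad \<alpha> \<beta> (b + (- (w * \<epsilon> / w0)) *\<^sub>R d)
      = w * sep_quad \<alpha> \<beta> y + w0 * sep_quad \<alpha> \<beta> b + w * \<epsilon> * (\<epsilon> * H - 2 * G)"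
    unfolding expand G_def H_def using \<open>0 < w0\<close>
    by (simp add: field_simps power2_eq_square)
  moreover have "w * \<epsilon> * (\<epsilon> * H - 2 * G) < 0"
    using e \<open>0 < w\<close> \<open>0 < G\<close> by (intro mult_pos_neg) auto
  ultimately show ?thesis
    using that[of \<epsilon>] e by (simp add: d_def)
qed

text \<open>Under the hypotheses below, the average of \<open>q\<close> over points of the simplex and one affine
  point \<open>b0\<close>, possibly with negative entries, is at least the minimum of \<open>q\<close> on the simplex,
  provided that the mean of all the points is nonnegative and that \<open>b0\<close> vanishes wherever
  \<open>q\<close> is not strictly convex. Weights \<open>w i\<close> may be zero, so that the
  full index type can be used for the family of points.\<close>

lemma average_ge_simplex_min:
  fixes \<alpha> \<beta> b0 :: "real ^ 'n" and w :: "'n \<Rightarrow> real" and A0 :: "real ^ 'n ^ 'n"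
  assumes z: "\<And>y. y \<in> std_simplex \<Longrightarrow> z \<le> sep_quad \<alpha> \<beta> y"
    and w: "\<And>i. 0 \<le> w i" and w0: "0 < w0" and w1: "(\<Sum>i\<in>UNIV. w i) + w0 = 1"
    and A0: "\<And>i. A0 $ i \<in> std_simplex"
    and b0: "(\<Sum>j\<in>UNIV. b0 $ j) = 1" "\<And>j. \<beta> $ j \<le> 0 \<Longrightarrow> b0 $ j = 0"
    and mean: "\<And>j. 0 \<le> (\<Sum>i\<in>UNIV. w i * A0 $ i $ j) + w0 * b0 $ j"
  shows "z \<le> (\<Sum>i\<in>UNIV. w i * sep_quad \<alpha> \<beta> (A0 $ i)) + w0 * sep_quad \<alpha> \<beta> b0"
proof -
  define x where "x = (\<Sum>i\<in>UNIV. w i *\<^sub>R A0 $ i) + w0 *\<^sub>R b0"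
  define b where "b A = (1 / w0) *\<^sub>R (x - (\<Sum>i\<in>UNIV. w i *\<^sub>R A $ i))" for A :: "real ^ 'n ^ 'n"
  define g where "g A = (\<Sum>i\<in>UNIV. w i * sep_quad \<alpha> \<beta> (A $ i)) + w0 * sep_quad \<alpha> \<beta> (b A)" for A
  define K where "K = {A :: real ^ 'n ^ 'n. \<forall>i. A $ i \<in> std_simplex
      \<and> (\<forall>j. \<beta> $ j \<le> 0 \<longrightarrow> A $ i $ j = A0 $ i $ j)}"
  have b_nth: "w0 * b A $ j = x $ j - (\<Sum>i\<in>UNIV. w i * A $ i $ j)" for A j
    using w0 by (simp add: b_def)
  have x_nth: "x $ j = (\<Sum>i\<in>UNIV. w i * A0 $ i $ j) + w0 * b0 $ j" for j
    by (simp add: x_def)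
  have "b A0 = b0" using w0 by (simp add: b_def x_def)
  have "A0 \<in> K" using A0 by (simp add: K_def)
  have "compact K"
  proof -
    have "norm A \<le> real CARD('n)" if "A \<in> K" for A
    proof -
      have "norm A \<le> (\<Sum>i\<in>UNIV. norm (A $ i))"
        by (simp add: norm_vec_def L2_set_le_sum)
      also have "\<dots> \<le> (\<Sum>i\<in>(UNIV :: 'n set). 1)"
        using that by (intro sum_mono simplex_norm_le_one) (auto simp: K_def)
      finally show ?thesis by simp
    qed
    then have "bounded K" by (auto simp: bounded_iff)
    moreover have "closed K"
    proof -
      have "closed {A :: real ^ 'n ^ 'n. A $ i \<in> std_simplex}" for i
        using continuous_closed_vimage[OF closed_std_simplex, of "\<lambda>A :: real ^ 'n ^ 'n. A $ i"]
        by (simp add: vimage_def continuous_intros)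
      moreover have "closed {A :: real ^ 'n ^ 'n. A $ i $ j = A0 $ i $ j}" for i j
        by (intro closed_Collect_eq continuous_intros)
      ultimately show ?thesis
        unfolding K_def by (intro closed_Collect_all closed_Collect_conj closed_Collect_imp) auto
    qed
    ultimately show ?thesis by (simp add: compact_eq_bounded_closed)
  qed
  moreover have "continuous_on K g"
    unfolding g_def b_def by (intro continuous_intros)
  ultimately obtain A where A: "A \<in> K" and Amin: "\<And>B. B \<in> K \<Longrightarrow> g A \<le> g B"
    using continuous_attains_inf[of K g] \<open>A0 \<in> K\<close> by blast
  have Ais: "A $ i \<in> std_simplex" for i using A by (simp add: K_def)
  then have A_nonneg: "0 \<le> A $ i $ j" for i j by (simp add: std_simplex_def)
  have A_sum: "(\<Sum>j\<in>UNIV. A $ i $ j) = 1" for i by (rule sum_eq_one_simplex[OF Ais])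
  have b_zero: "b A $ j = 0" if "\<beta> $ j \<le> 0" for j
  proof -
    have "w0 * b A $ j = w0 * b0 $ j"
      using A that unfolding b_nth x_nth by (simp add: K_def)
    then show ?thesis using b0(2)[OF that] w0 by simp
  qed
  have b_sum: "(\<Sum>j\<in>UNIV. b A $ j) = 1"
  proof -
    have rows: "(\<Sum>j\<in>UNIV. \<Sum>i\<in>UNIV. w i * B $ i $ j) = (\<Sum>i\<in>UNIV. w i)"
      if "\<And>i. (\<Sum>j\<in>UNIV. B $ i $ j) = 1" for B :: "real ^ 'n ^ 'n"
      using that by (subst sum.swap) (simp flip: sum_distrib_left)
    have "(\<Sum>j\<in>UNIV. x $ j) = 1"
      unfolding x_nth using rows[of A0] sum_eq_one_simplex[OF A0] b0(1) w1
      by (simp add: sum.distrib flip: sum_distrib_left)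
    moreover have "w0 * (\<Sum>j\<in>UNIV. b A $ j) = (\<Sum>j\<in>UNIV. x $ j) - (\<Sum>i\<in>UNIV. w i)"
      using rows[of A] A_sum by (simp add: sum_distrib_left b_nth sum_subtractf)
    ultimately have "w0 * (\<Sum>j\<in>UNIV. b A $ j) = w0" using w1 by simp
    then show ?thesis using w0 by simp
  qed
  have b_nonneg: "0 \<le> b A $ j" for j
  proof (rule ccontr)
    assume neg: "\<not> 0 \<le> b A $ j"
    then have bj: "0 < \<beta> $ j" using b_zero[of j] by force
    \<comment> \<open>The mean is nonnegative at \<open>j\<close>, so some point of positive weight is positive there.\<close>
    have "0 < (\<Sum>i\<in>UNIV. w i * A $ i $ j)"
    proof -
      have "w0 * b A $ j < 0" using neg w0 by (simp add: mult_pos_neg)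
      moreover have "0 \<le> x $ j" using mean x_nth by simp
      ultimately show ?thesis using b_nth[of A j] by linarith
    qed
    then obtain i where "0 < w i * A $ i $ j"
      by (metis (no_types, lifting) not_less sum_nonpos)
    then have wi: "0 < w i" and Aij: "0 < A $ i $ j"
      using w[of i] A_nonneg[of i j] by (auto simp: zero_less_mult_iff)
    \<comment> \<open>Row \<open>i\<close> and \<open>b A\<close> both sum to one, so the excess of row \<open>i\<close> at \<open>j\<close> forces a deficit
      elsewhere.\<close>
    obtain k where k: "A $ i $ k < b A $ k"
    proof (rule ccontr)
      assume "\<not> thesis"
      then have "b A $ k \<le> A $ i $ k" for k using that by (meson not_le)
      moreover have "b A $ j < A $ i $ j" using neg Aij by simp
      ultimately have "(\<Sum>k\<in>UNIV. b A $ k) < (\<Sum>k\<in>UNIV. A $ i $ k)"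
        by (intro sum_strict_mono_ex1) auto
      then show False using b_sum A_sum by simp
    qed
    have bk: "0 < \<beta> $ k" using k b_zero[of k] A_nonneg[of i k] by force
    have "j \<noteq> k" using k neg Aij by auto
    obtain \<epsilon> where e: "0 < \<epsilon>" "\<epsilon> \<le> A $ i $ j"
      and less: "w i * sep_quad \<alpha> \<beta> (A $ i + \<epsilon> *\<^sub>R (axis k 1 - axis j 1))
         + w0 * sep_quad \<alpha> \<beta> (b A - (w i * \<epsilon> / w0) *\<^sub>R (axis k 1 - axis j 1))
         < w i * sep_quad \<alpha> \<beta> (A $ i) + w0 * sep_quad \<alpha> \<beta> (b A)"
      using sep_quad_exchange[of "w i" w0 j k \<beta> "A $ i $ j" "b A" "A $ i" \<alpha>]
        wi w0 \<open>j \<noteq> k\<close> bj bk Aij neg k by auto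
    define d :: "real ^ 'n" where "d = axis k 1 - axis j 1"
    define B where "B = (\<chi> l. if l = i then A $ i + \<epsilon> *\<^sub>R d else A $ l)"
    have "B \<in> K"
    proof -
      have "A $ i + \<epsilon> *\<^sub>R d \<in> std_simplex"
      proof (rule std_simplexI)
        show "0 \<le> (A $ i + \<epsilon> *\<^sub>R d) $ l" for l
          using A_nonneg[of i l] e by (auto simp: d_def axis_def)
        have "(\<Sum>l\<in>UNIV. d $ l) = 0"
          by (simp add: d_def axis_def sum_subtractf)
        then show "(\<Sum>l\<in>UNIV. (A $ i + \<epsilon> *\<^sub>R d) $ l) = 1"
          using A_sum[of i] by (simp add: sum.distrib flip: sum_distrib_left)
      qed
      moreover have "d $ l = 0" if "\<beta> $ l \<le> 0" for l
        using that bj bk by (auto simp: d_def axis_def)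
      ultimately show ?thesis using A by (auto simp: K_def B_def)
    qed
    have "b B = b A - (w i * \<epsilon> / w0) *\<^sub>R d"
    proof -
      have "(\<Sum>l\<in>UNIV. w l *\<^sub>R B $ l) = (\<Sum>l\<in>UNIV. w l *\<^sub>R A $ l + (if l = i then (w i * \<epsilon>) *\<^sub>R d else 0))"
        by (intro sum.cong) (auto simp: B_def algebra_simps)
      also have "\<dots> = (\<Sum>l\<in>UNIV. w l *\<^sub>R A $ l) + (w i * \<epsilon>) *\<^sub>R d"
        by (simp add: sum.distrib)
      finally show ?thesis by (simp add: b_def algebra_simps)
    qed
    moreover have "(\<Sum>l\<in>UNIV. w l * sep_quad \<alpha> \<beta> (B $ l)) = (\<Sum>l\<in>UNIV. w l * sep_quad \<alpha> \<beta> (A $ l))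
        - w i * sep_quad \<alpha> \<beta> (A $ i) + w i * sep_quad \<alpha> \<beta> (A $ i + \<epsilon> *\<^sub>R d)"
    proof -
      have "(\<Sum>l\<in>UNIV - {i}. w l * sep_quad \<alpha> \<beta> (B $ l)) = (\<Sum>l\<in>UNIV - {i}. w l * sep_quad \<alpha> \<beta> (A $ l))"
        by (intro sum.cong) (auto simp: B_def)
      then show ?thesis
        by (simp add: sum.remove[of UNIV i] B_def)
    qed
    ultimately have "g B < g A" using less by (simp add: g_def d_def)
    then show False using Amin[OF \<open>B \<in> K\<close>] by simp
  qed
  have "z = (\<Sum>i\<in>UNIV. w i * z) + w0 * z"
    using w1 by (metis distrib_right mult_1 sum_distrib_right)
  also have "\<dots> \<le> g A"
    unfolding g_def using w w0 Ais std_simplexI[OF b_nonneg b_sum]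
    by (intro add_mono sum_mono mult_left_mono z) auto
  also have "\<dots> \<le> g A0" by (rule Amin[OF \<open>A0 \<in> K\<close>])
  finally show ?thesis by (simp add: g_def \<open>b A0 = b0\<close>)
qed


section \<open>The lower bound on the relaxation\<close>

text \<open>The quadratic form of the Schur complement of a diagonal principal block is nonnegative:
  it is the value of the original form at \<open>v - c\<close>, where \<open>c\<close> is supported on the block and
  \<open>X *v c\<close> agrees with \<open>X *v v\<close> there.\<close>

lemma psd_schur_complement:
  fixes X :: "real ^ 'n ^ 'n"
  assumes sym: "transpose X = X" and psd: "\<And>v. 0 \<le> v \<bullet> (X *v v)"
    and diag: "\<And>i k. \<lbrakk>i \<in> I; k \<in> I; i \<noteq> k\<rbrakk> \<Longrightarrow> X $ i $ k = 0"
    and pos: "\<And>i. i \<in> I \<Longrightarrow> 0 < X $ i $ i"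
  shows "(\<Sum>i\<in>I. ((X *v v) $ i)\<^sup>2 / X $ i $ i) \<le> v \<bullet> (X *v v)"
proof -
  define c where "c = (\<chi> i. if i \<in> I then (X *v v) $ i / X $ i $ i else 0)"
  have on_I: "c \<bullet> u = (\<Sum>i\<in>I. (X *v v) $ i / X $ i $ i * u $ i)" for u
  proof -
    have "c \<bullet> u = (\<Sum>i\<in>UNIV. if i \<in> I then (X *v v) $ i / X $ i $ i * u $ i else 0)"
      unfolding inner_vec_def by (intro sum.cong) (auto simp: c_def)
    then show ?thesis by (simp add: sum.If_cases)
  qed
  have Xc: "(X *v c) $ i = (X *v v) $ i" if "i \<in> I" for i
  proof -
    have "(X *v c) $ i = (\<Sum>k\<in>UNIV. if k = i then X $ i $ i * c $ i else 0)"
      using that diag[of i]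
      by (simp only: matrix_vector_mult_def vec_lambda_beta, intro sum.cong) (auto simp: c_def)
    also have "\<dots> = X $ i $ i * c $ i" by simp
    also have "\<dots> = (X *v v) $ i" using that pos[OF that] by (simp add: c_def)
    finally show ?thesis .
  qed
  have cXv: "c \<bullet> (X *v v) = (\<Sum>i\<in>I. ((X *v v) $ i)\<^sup>2 / X $ i $ i)"
    by (simp add: on_I power2_eq_square)
  have "c \<bullet> (X *v c) = (\<Sum>i\<in>I. ((X *v v) $ i)\<^sup>2 / X $ i $ i)"
    by (simp add: on_I Xc power2_eq_square)
  moreover have "(v - c) \<bullet> (X *v (v - c)) = v \<bullet> (X *v v) - 2 * (c \<bullet> (X *v v)) + c \<bullet> (X *v c)"
    using inner_matrix_vector_commute[OF sym, of v c]
    by (simp add: matrix_vector_mult_diff_distrib inner_diff)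
  ultimately show ?thesis using psd[of "v - c"] cXv by simp
qed

lemma trace_prod_ge_of_diagonal_block:
  fixes \<alpha> \<beta> :: "real ^ 'n" and X :: "real ^ 'n ^ 'n"
  assumes z: "\<And>y. y \<in> std_simplex \<Longrightarrow> z \<le> sep_quad \<alpha> \<beta> y"
    and X: "X \<in> dnn_feasible"
    and diag: "\<And>i k. \<lbrakk>\<beta> $ i \<le> 0; \<beta> $ k \<le> 0; i \<noteq> k\<rbrakk> \<Longrightarrow> X $ i $ k = 0"
  shows "z \<le> trace_prod (quad_mat \<alpha> \<beta>) X"
proof -
  have sym: "transpose X = X" and psd: "\<And>v. 0 \<le> v \<bullet> (X *v v)"
    and X_nonneg: "\<And>i j. 0 \<le> X $ i $ j" and X_sum: "(\<Sum>i\<in>UNIV. \<Sum>j\<in>UNIV. X $ i $ j) = 1"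
    using X by (auto simp: dnn_feasible_def dnn_cone_def trace_prod_ones)
  define x where "x = X *v 1"
  have x_nth: "x $ i = (\<Sum>j\<in>UNIV. X $ i $ j)" for i
    by (simp add: x_def matrix_vector_mult_def)
  have x_nonneg: "0 \<le> x $ i" for i by (simp add: x_nth sum_nonneg X_nonneg)
  have x_sum: "1 \<bullet> x = 1" using X_sum by (simp add: inner_vec_def x_nth)
  have row_zero: "X $ i $ j = 0" if "x $ i = 0" for i j
    using that X_nonneg by (simp add: x_nth sum_nonneg_eq_0_iff)
  define I where "I = {i. \<beta> $ i \<le> 0 \<and> 0 < x $ i}"
  have form: "(s *\<^sub>R 1 + t *\<^sub>R axis j 1) \<bullet> (X *v (s *\<^sub>R 1 + t *\<^sub>R axis j 1))
      = s\<^sup>2 + 2 * (s * t) * x $ j + t\<^sup>2 * X $ j $ j"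
    and image: "(X *v (s *\<^sub>R 1 + t *\<^sub>R axis j 1)) $ i = s * x $ i + t * X $ i $ j" for s t i j
  proof -
    have X_axis: "(X *v axis j 1) $ i = X $ i $ j" for i
      by (simp add: matrix_vector_mul_component inner_axis)
    have lin: "X *v (s *\<^sub>R 1 + t *\<^sub>R axis j 1) = s *\<^sub>R x + t *\<^sub>R (X *v axis j 1)"
      unfolding x_def matrix_vector_right_distrib
      by (simp add: matrix_vector_mult_scaleR)
    then show "(X *v (s *\<^sub>R 1 + t *\<^sub>R axis j 1)) $ i = s * x $ i + t * X $ i $ j"
      by (simp add: X_axis)
    have "1 \<bullet> (X *v axis j 1) = x $ j"
      using inner_matrix_vector_commute[OF sym, of 1 "axis j 1"]
      by (simp add: x_def inner_axis')
    then show "(s *\<^sub>R 1 + t *\<^sub>R axis j 1) \<bullet> (X *v (s *\<^sub>R 1 + t *\<^sub>R axis j 1))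
      = s\<^sup>2 + 2 * (s * t) * x $ j + t\<^sup>2 * X $ j $ j"
      unfolding lin using x_sum X_axis
      by (simp add: inner_add inner_axis' power2_eq_square algebra_simps)
  qed
  have diag_pos: "0 < X $ i $ i" if "i \<in> I" for i
  proof -
    have "0 \<le> X $ i $ i * s\<^sup>2 + 2 * x $ i * (s * t) + 1 * t\<^sup>2" for s t
      using psd[of "t *\<^sub>R 1 + s *\<^sub>R axis i 1"] unfolding form by (simp add: algebra_simps)
    from psd_binary_form(2)[OF this] show ?thesis
      using that X_nonneg[of i i] by (auto simp: I_def less_le)
  qed
  \<comment> \<open>The distribution: row \<open>i\<close>, scaled to sum one, for \<open>i \<in> I\<close>; any vertex, with weight zero,
    for \<open>i \<notin> I\<close>. The numbers \<open>r j\<close> and \<open>c j\<close> are what it leaves of the mean and of the second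
    moments.\<close>
  define w where "w i = (if i \<in> I then (x $ i)\<^sup>2 / X $ i $ i else 0)" for i
  define w0 where "w0 = 1 - (\<Sum>i\<in>UNIV. w i)"
  define A :: "real ^ 'n ^ 'n" where "A = (\<chi> i. if i \<in> I then (1 / x $ i) *\<^sub>R X $ i else axis i 1)"
  define r where "r j = x $ j - (\<Sum>i\<in>UNIV. w i * A $ i $ j)" for j
  define c where "c j = X $ j $ j - (\<Sum>i\<in>UNIV. w i * (A $ i $ j)\<^sup>2)" for j
  have wA: "w i * A $ i $ j = (if i \<in> I then x $ i * X $ i $ j / X $ i $ i else 0)"
    "w i * (A $ i $ j)\<^sup>2 = (if i \<in> I then (X $ i $ j)\<^sup>2 / X $ i $ i else 0)" for i j
    by (auto simp: w_def A_def I_def field_simps power2_eq_square)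
  have w_nonneg: "0 \<le> w i" for i by (simp add: w_def X_nonneg)
  have A_simplex: "A $ i \<in> std_simplex" for i
  proof (rule std_simplexI)
    show "0 \<le> A $ i $ j" for j using X_nonneg x_nonneg by (simp add: A_def axis_def)
    show "(\<Sum>j\<in>UNIV. A $ i $ j) = 1"
      by (cases "i \<in> I")
        (auto simp: A_def axis_def I_def x_nth simp flip: sum_divide_distrib)
  qed
  \<comment> \<open>This is the Schur complement's form restricted to the span of \<open>e\<close> and \<open>e\<^sub>j\<close>.\<close>
  have residual: "0 \<le> w0 * s\<^sup>2 + 2 * r j * (s * t) + c j * t\<^sup>2" for s t j
  proof -
    have "(\<Sum>i\<in>I. (s * x $ i + t * X $ i $ j)\<^sup>2 / X $ i $ i) \<le> s\<^sup>2 + 2 * (s * t) * x $ j + t\<^sup>2 * X $ j $ j"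
      using psd_schur_complement[OF sym psd, of I "s *\<^sub>R 1 + t *\<^sub>R axis j 1"] diag diag_pos
      unfolding form image by (auto simp: I_def)
    moreover have "(\<Sum>i\<in>I. (s * x $ i + t * X $ i $ j)\<^sup>2 / X $ i $ i)
      = s\<^sup>2 * (\<Sum>i\<in>UNIV. w i) + 2 * (s * t) * (\<Sum>i\<in>UNIV. w i * A $ i $ j)
          + t\<^sup>2 * (\<Sum>i\<in>UNIV. w i * (A $ i $ j)\<^sup>2)"
    proof -
      have "(\<Sum>i\<in>I. (s * x $ i + t * X $ i $ j)\<^sup>2 / X $ i $ i)
        = (\<Sum>i\<in>UNIV. if i \<in> I then (s * x $ i + t * X $ i $ j)\<^sup>2 / X $ i $ i else 0)"
        by (simp add: sum.If_cases)
      also have "\<dots> = (\<Sum>i\<in>UNIV. s\<^sup>2 * w i + 2 * (s * t) * (w i * A $ i $ j) + t\<^sup>2 * (w i * (A $ i $ j)\<^sup>2))"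
        unfolding wA by (intro sum.cong)
          (auto simp: w_def power2_eq_square algebra_simps add_divide_distrib)
      also have "\<dots> = s\<^sup>2 * (\<Sum>i\<in>UNIV. w i) + 2 * (s * t) * (\<Sum>i\<in>UNIV. w i * A $ i $ j)
          + t\<^sup>2 * (\<Sum>i\<in>UNIV. w i * (A $ i $ j)\<^sup>2)"
        by (simp only: sum.distrib sum_distrib_left)
      finally show ?thesis .
    qed
    ultimately show ?thesis
      by (simp add: w0_def r_def c_def algebra_simps)
  qed
  note w0_nonneg = psd_binary_form(1)[OF residual]
    and r_zero = psd_binary_form(2)[OF residual] and c_ge = psd_binary_form(3)[OF residual]
  have nonpos: "r j = 0 \<and> c j = 0" if "\<beta> $ j \<le> 0" for j
  proof (cases "j \<in> I")
    case True
    have "w i * A $ i $ j = (if i = j then x $ j else 0)"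
      "w i * (A $ i $ j)\<^sup>2 = (if i = j then X $ j $ j else 0)" for i
      unfolding wA using True diag_pos[OF True] diag[of i j] that
      by (auto simp: I_def power2_eq_square)
    then show ?thesis by (simp add: r_def c_def)
  next
    case False
    then have "x $ j = 0" using that x_nonneg[of j] by (auto simp: I_def)
    moreover from this have "X $ i $ j = 0" for i
      using row_zero[of j i] symmetric_nth[OF sym, of i j] by simp
    then have "w i * A $ i $ j = 0" "w i * (A $ i $ j)\<^sup>2 = 0" for i by (simp_all add: wA)
    ultimately show ?thesis using row_zero[of j j]
      by (simp only: r_def c_def sum.neutral_const diff_self simp_thms)
  qed
  \<comment> \<open>If \<open>w0 = 0\<close>, then all \<open>r j\<close> vanish and \<open>b = 0\<close>; the two equations below still hold.\<close>
  define b where "b = (\<chi> j. r j / w0)"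
  have w0b: "w0 * b $ j = r j" "w0 * (b $ j)\<^sup>2 = (r j)\<^sup>2 / w0" for j
    using r_zero[of j] by (auto simp: b_def field_simps power2_eq_square)
  have "(\<Sum>i\<in>UNIV. w i * sep_quad \<alpha> \<beta> (A $ i)) + w0 * sep_quad \<alpha> \<beta> b
      \<le> trace_prod (quad_mat \<alpha> \<beta>) X"
  proof -
    have "(\<Sum>i\<in>UNIV. w i * sep_quad \<alpha> \<beta> (A $ i))
        = (\<Sum>i\<in>UNIV. \<Sum>j\<in>UNIV. 2 * \<alpha> $ j * (w i * A $ i $ j) + \<beta> $ j * (w i * (A $ i $ j)\<^sup>2))"
      by (simp add: sep_quad_def sum.distrib sum_distrib_left algebra_simps)
    also have "\<dots> = (\<Sum>j\<in>UNIV. 2 * \<alpha> $ j * (x $ j - r j) + \<beta> $ j * (X $ j $ j - c j))"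
      by (subst sum.swap) (simp add: r_def c_def sum.distrib sum_distrib_left)
    finally have 1: "(\<Sum>i\<in>UNIV. w i * sep_quad \<alpha> \<beta> (A $ i))
      = (\<Sum>j\<in>UNIV. 2 * \<alpha> $ j * (x $ j - r j) + \<beta> $ j * (X $ j $ j - c j))" .
    have "w0 * sep_quad \<alpha> \<beta> b
        = (\<Sum>j\<in>UNIV. 2 * \<alpha> $ j * (w0 * b $ j) + \<beta> $ j * (w0 * (b $ j)\<^sup>2))"
      by (simp add: sep_quad_def sum.distrib sum_distrib_left algebra_simps)
    then have "(\<Sum>i\<in>UNIV. w i * sep_quad \<alpha> \<beta> (A $ i)) + w0 * sep_quad \<alpha> \<beta> b
      = (\<Sum>j\<in>UNIV. 2 * \<alpha> $ j * x $ j + \<beta> $ j * X $ j $ j - \<beta> $ j * (c j - (r j)\<^sup>2 / w0))"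
      unfolding 1 w0b by (simp add: algebra_simps flip: sum.distrib)
    also have "\<dots> \<le> (\<Sum>j\<in>UNIV. 2 * \<alpha> $ j * x $ j + \<beta> $ j * X $ j $ j)"
    proof (rule sum_mono)
      fix j
      have "0 \<le> \<beta> $ j * (c j - (r j)\<^sup>2 / w0)"
        using nonpos[of j] c_ge[of j] by (cases "\<beta> $ j \<le> 0") auto
      then show "2 * \<alpha> $ j * x $ j + \<beta> $ j * X $ j $ j - \<beta> $ j * (c j - (r j)\<^sup>2 / w0)
        \<le> 2 * \<alpha> $ j * x $ j + \<beta> $ j * X $ j $ j" by simp
    qed
    also have "\<dots> = trace_prod (quad_mat \<alpha> \<beta>) X"
      unfolding trace_prod_quad_mat[OF sym] x_nth
      by (simp add: sum.distrib sum_distrib_left mult.assoc)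
    finally show ?thesis .
  qed
  moreover have "z \<le> (\<Sum>i\<in>UNIV. w i * sep_quad \<alpha> \<beta> (A $ i)) + w0 * sep_quad \<alpha> \<beta> b"
  proof (cases "w0 = 0")
    case True
    have "z = (\<Sum>i\<in>UNIV. w i * z)"
      using True by (simp add: w0_def flip: sum_distrib_right)
    also have "\<dots> \<le> (\<Sum>i\<in>UNIV. w i * sep_quad \<alpha> \<beta> (A $ i))"
      by (intro sum_mono mult_left_mono z A_simplex w_nonneg)
    finally show ?thesis using True by simp
  next
    case False
    then have "0 < w0" using w0_nonneg by simp
    show ?thesis
    proof (rule average_ge_simplex_min[OF z w_nonneg \<open>0 < w0\<close> _ A_simplex])
      show "(\<Sum>i\<in>UNIV. w i) + w0 = 1" by (simp add: w0_def)
      have "(\<Sum>j\<in>UNIV. r j) = 1 - (\<Sum>j\<in>UNIV. \<Sum>i\<in>UNIV. w i * A $ i $ j)"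
        using x_sum by (simp add: r_def sum_subtractf inner_vec_def)
      also have "\<dots> = w0"
        by (subst sum.swap) (simp add: w0_def sum_eq_one_simplex[OF A_simplex] flip: sum_distrib_left)
      finally show "(\<Sum>j\<in>UNIV. b $ j) = 1"
        using False by (simp add: b_def flip: sum_divide_distrib)
      show "b $ j = 0" if "\<beta> $ j \<le> 0" for j using nonpos[OF that] by (simp add: b_def)
      show "0 \<le> (\<Sum>i\<in>UNIV. w i * A $ i $ j) + w0 * b $ j" for j
        using x_nonneg[of j] by (simp add: w0b r_def)
    qed auto
  qed
  ultimately show ?thesis by linarith
qed

section \<open>Diagonalizing the block where the coefficients are nonpositive\<close>

text \<open>Within each row \<open>i \<in> N\<close>, all entries with column in \<open>N\<close> are collected on the diagonal; the
  other entries are kept.\<close>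

definition diagonalize_block :: "'n set \<Rightarrow> real ^ 'n ^ 'n \<Rightarrow> real ^ 'n ^ 'n" where
  "diagonalize_block N X = (\<chi> i j. if i \<in> N \<and> j \<in> N
     then (if i = j then (\<Sum>k\<in>N. X $ i $ k) else 0) else X $ i $ j)"

lemma diagonalize_block_row_sum:
  "(\<Sum>j\<in>UNIV. diagonalize_block N X $ i $ j) = (\<Sum>j\<in>UNIV. X $ i $ j)"
proof (cases "i \<in> N")
  case True
  have "(\<Sum>j\<in>UNIV. diagonalize_block N X $ i $ j)
      = (\<Sum>j\<in>N. diagonalize_block N X $ i $ j) + (\<Sum>j\<in>-N. diagonalize_block N X $ i $ j)"
    by (metis finite sum.subset_diff subset_UNIV Compl_eq_Diff_UNIV add.commute)
  also have "\<dots> = (\<Sum>j\<in>N. X $ i $ j) + (\<Sum>j\<in>-N. X $ i $ j)"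
    using True by (simp add: diagonalize_block_def)
  also have "\<dots> = (\<Sum>j\<in>UNIV. X $ i $ j)"
    by (metis finite sum.subset_diff subset_UNIV Compl_eq_Diff_UNIV add.commute)
  finally show ?thesis .
qed (simp add: diagonalize_block_def)

text \<open>The difference of the two forms is the Laplacian \<open>\<Sum>i j. X\<^sub>i\<^sub>j (v\<^sub>i - v\<^sub>j)\<^sup>2 / 2\<close> over \<open>i, j \<in> N\<close>.\<close>

lemma diagonalize_block_form_ge:
  fixes X :: "real ^ 'n ^ 'n"
  assumes sym: "transpose X = X" and nonneg: "\<And>i j. 0 \<le> X $ i $ j"
  shows "v \<bullet> (X *v v) \<le> v \<bullet> (diagonalize_block N X *v v)"
proof -
  define L where "L i j = (if i \<in> N \<and> j \<in> N then X $ i $ j else 0)" for i j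
  have Lsym: "L i j = L j i" for i j by (simp add: L_def symmetric_nth[OF sym, of i j])
  have D: "diagonalize_block N X $ i $ j
      = X $ i $ j - L i j + (if i = j then (\<Sum>k\<in>UNIV. L i k) else 0)" for i j
    by (auto simp: diagonalize_block_def L_def sum.If_cases)
  have "v \<bullet> (diagonalize_block N X *v v) = v \<bullet> (X *v v)
      + (\<Sum>i\<in>UNIV. \<Sum>j\<in>UNIV. L i j * (v $ i)\<^sup>2) - (\<Sum>i\<in>UNIV. \<Sum>j\<in>UNIV. L i j * v $ i * v $ j)"
  proof -
    have "v \<bullet> (diagonalize_block N X *v v) = (\<Sum>i\<in>UNIV. \<Sum>j\<in>UNIV. X $ i $ j * v $ i * v $ j
        - L i j * v $ i * v $ j + (if i = j then (\<Sum>k\<in>UNIV. L i k) * v $ i * v $ j else 0))"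
      unfolding inner_matrix_vector_eq_sum D
      by (intro sum.cong) (auto simp: algebra_simps)
    then show ?thesis
      by (simp add: inner_matrix_vector_eq_sum sum.distrib sum_subtractf sum_distrib_right
          power2_eq_square mult.assoc)
  qed
  moreover have "2 * ((\<Sum>i\<in>UNIV. \<Sum>j\<in>UNIV. L i j * (v $ i)\<^sup>2)
      - (\<Sum>i\<in>UNIV. \<Sum>j\<in>UNIV. L i j * v $ i * v $ j))
      = (\<Sum>i\<in>UNIV. \<Sum>j\<in>UNIV. L i j * (v $ i - v $ j)\<^sup>2)"
  proof -
    have swap: "(\<Sum>i\<in>UNIV. \<Sum>j\<in>UNIV. L i j * (v $ i)\<^sup>2) = (\<Sum>i\<in>UNIV. \<Sum>j\<in>UNIV. L i j * (v $ j)\<^sup>2)"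
      by (subst sum.swap) (simp add: Lsym)
    have "(\<Sum>i\<in>UNIV. \<Sum>j\<in>UNIV. L i j * (v $ i - v $ j)\<^sup>2)
        = (\<Sum>i\<in>UNIV. \<Sum>j\<in>UNIV. L i j * (v $ i)\<^sup>2 + L i j * (v $ j)\<^sup>2 - 2 * (L i j * v $ i * v $ j))"
      by (intro sum.cong) (auto simp: power2_eq_square algebra_simps)
    then show ?thesis
      using swap by (simp add: sum.distrib sum_subtractf flip: sum_distrib_left)
  qed
  moreover have "0 \<le> (\<Sum>i\<in>UNIV. \<Sum>j\<in>UNIV. L i j * (v $ i - v $ j)\<^sup>2)"
    by (intro sum_nonneg) (auto simp: L_def nonneg)
  ultimately have "2 * (v \<bullet> (diagonalize_block N X *v v) - v \<bullet> (X *v v)) \<ge> 0" by simp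
  then show ?thesis by simp
qed

lemma diagonalize_block_dnn_feasible:
  assumes "X \<in> dnn_feasible"
  shows "diagonalize_block N X \<in> dnn_feasible"
proof -
  have sym: "transpose X = X" and psd: "\<And>v. 0 \<le> v \<bullet> (X *v v)"
    and nonneg: "\<And>i j. 0 \<le> X $ i $ j" and total: "(\<Sum>i\<in>UNIV. \<Sum>j\<in>UNIV. X $ i $ j) = 1"
    using assms by (auto simp: dnn_feasible_def dnn_cone_def trace_prod_ones)
  have "transpose (diagonalize_block N X) = diagonalize_block N X"
    using symmetric_nth[OF sym] by (auto simp: vec_eq_iff transpose_def diagonalize_block_def)
  moreover have "0 \<le> v \<bullet> (diagonalize_block N X *v v)" for v
    using psd[of v] diagonalize_block_form_ge[OF sym nonneg, of v N] by linarith
  moreover have "0 \<le> diagonalize_block N X $ i $ j" for i j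
    by (simp add: diagonalize_block_def nonneg sum_nonneg)
  ultimately show ?thesis
    by (simp add: dnn_feasible_def dnn_cone_def trace_prod_ones diagonalize_block_row_sum total)
qed

lemma trace_prod_diagonalize_block_le:
  assumes "X \<in> dnn_feasible" and N: "\<And>i. i \<in> N \<Longrightarrow> \<beta> $ i \<le> 0"
  shows "trace_prod (quad_mat \<alpha> \<beta>) (diagonalize_block N X) \<le> trace_prod (quad_mat \<alpha> \<beta>) X"
proof -
  have sym: "transpose X = X" "transpose (diagonalize_block N X) = diagonalize_block N X"
    and nonneg: "\<And>i j. 0 \<le> X $ i $ j"
    using assms(1) diagonalize_block_dnn_feasible[OF assms(1), of N]
    by (auto simp: dnn_feasible_def dnn_cone_def)
  have "\<beta> $ i * diagonalize_block N X $ i $ i \<le> \<beta> $ i * X $ i $ i" for i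
  proof (cases "i \<in> N")
    case True
    then have "X $ i $ i \<le> (\<Sum>k\<in>N. X $ i $ k)"
      by (intro member_le_sum) (auto simp: nonneg)
    then show ?thesis
      using True N[OF True] by (simp add: diagonalize_block_def mult_left_mono_neg)
  qed (simp add: diagonalize_block_def)
  then show ?thesis
    unfolding trace_prod_quad_mat[OF sym(1)] trace_prod_quad_mat[OF sym(2)]
      diagonalize_block_row_sum
    by (simp add: sum_mono)
qed

section \<open>Tightness of the relaxation\<close>

theorem proposition5p7:
  fixes \<alpha> \<beta> :: "real ^ 'n"
  shows "\<exists>z. is_min_value (sep_quad \<alpha> \<beta>) std_simplex z
           \<and> is_min_value (trace_prod (quad_mat \<alpha> \<beta>)) dnn_feasible z"
proof -
  obtain x where x: "x \<in> std_simplex"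
    and le: "\<And>y. y \<in> std_simplex \<Longrightarrow> sep_quad \<alpha> \<beta> x \<le> sep_quad \<alpha> \<beta> y"
    using sep_quad_attains_min by blast
  have bound: "sep_quad \<alpha> \<beta> x \<le> trace_prod (quad_mat \<alpha> \<beta>) X" if "X \<in> dnn_feasible" for X
  proof -
    define N where "N = {i. \<beta> $ i \<le> 0}"
    have "sep_quad \<alpha> \<beta> x \<le> trace_prod (quad_mat \<alpha> \<beta>) (diagonalize_block N X)"
      by (rule trace_prod_ge_of_diagonal_block[OF le diagonalize_block_dnn_feasible[OF that]])
        (auto simp: N_def diagonalize_block_def)
    also have "\<dots> \<le> trace_prod (quad_mat \<alpha> \<beta>) X"
      by (rule trace_prod_diagonalize_block_le[OF that]) (simp add: N_def)
    finally show ?thesis .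
  qed
  have "is_min_value (sep_quad \<alpha> \<beta>) std_simplex (sep_quad \<alpha> \<beta> x)"
    using x le by (fastforce simp: is_min_value_def is_arg_min_linorder)
  moreover have "is_min_value (trace_prod (quad_mat \<alpha> \<beta>)) dnn_feasible (sep_quad \<alpha> \<beta> x)"
    using outer_prod_dnn_feasible[OF x] bound
    unfolding is_min_value_def is_arg_min_linorder by metis
  ultimately show ?thesis by blast
qed

end
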